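(* Let $(X,\mathscr{T})$ be a space which has a separately continuous weak selection. If each coarser selection topology on $X$ is compact (that is, $\mathscr{T}_\sigma$ is compact for every weak selection $\sigma$ for $X$ with $\mathscr{T}_\sigma\subset\mathscr{T}$), then $X$ is a quasi-king space.
   Context: All spaces are Hausdorff topological spaces. For a set $X$, let $\mathscr{F}_2(X)=\{S\subset X: 1\le |S|\le 2\}$. A weak selection for $X$ is a map $\sigma:\mathscr{F}_2(X)\to X$ with $\sigma(S)\in S$ for every $S\in\mathscr{F}_2(X)$. It generates the (total, antisymmetric, not necessarily transitive) relation $x\leq_\sigma y$ iff $\sigma(\{x,y\})=x$; write $x<_\sigma y$ if $x\leq_\sigma y$ and $x\neq y$. The selection topology $\mathscr{T}_\sigma$ on $X$ is the topology with subbase consisting of all sets $\{y\in X: y<_\sigma x\}$ and $\{y\in X: x<_\sigma y\}$, $x\in X$. A weak selection $\sigma$ for a space $(X,\mathscr{T})$ is separately continuous if $\mathscr{T}_\sigma\subset\mathscr{T}$. A point $q\in X$ is a quasi $\sigma$-king if for each $x\in X$ there are finitely many points $y_1,\dots,y_n\in X$ with $x\leq_\sigma y_1\leq_\sigma\dots\leq_\sigma y_n\leq_\sigma q$. A space $X$ is quasi-king if it has a separately continuous weak selection, and every separately continuous weak selection $\sigma$ for $X$ has a quasi $\sigma$-king. *)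

theory Defs
  imports "HOL-Analysis.Analysis"
begin

text \<open>A space is a value \<open>T :: 'a topology\<close> with underlying set \<open>topspace T\<close>. A map defined on
  \<open>F2 X\<close> is represented by a total function \<open>'a set \<Rightarrow> 'a\<close>; its values outside \<open>F2 X\<close> are irrelevant.\<close>

(* card is 0 on infinite sets, so 1 \<le> card S forces S to be finite and nonempty. *)
definition F2 :: "'a set \<Rightarrow> 'a set set" where
  "F2 X = {S. S \<subseteq> X \<and> 1 \<le> card S \<and> card S \<le> 2}"

definition weak_selection :: "'a set \<Rightarrow> ('a set \<Rightarrow> 'a) \<Rightarrow> bool" where
  "weak_selection X \<sigma> \<longleftrightarrow> (\<forall>S\<in>F2 X. \<sigma> S \<in> S)"

definition sel_le :: "('a set \<Rightarrow> 'a) \<Rightarrow> 'a \<Rightarrow> 'a \<Rightarrow> bool" where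
  "sel_le \<sigma> x y \<longleftrightarrow> \<sigma> {x, y} = x"

definition sel_less :: "('a set \<Rightarrow> 'a) \<Rightarrow> 'a \<Rightarrow> 'a \<Rightarrow> bool" where
  "sel_less \<sigma> x y \<longleftrightarrow> sel_le \<sigma> x y \<and> x \<noteq> y"

(* A subbase of a topology on X need not cover X (the empty intersection is X), whereas
   topology_generated_by \<S> has underlying set \<Union>\<S>. Inserting X accounts for this;
   it makes a difference only when X is a singleton. *)
definition selection_topology :: "'a set \<Rightarrow> ('a set \<Rightarrow> 'a) \<Rightarrow> 'a topology" where
  "selection_topology X \<sigma> = topology_generated_by
     (insert X ((\<lambda>x. {y \<in> X. sel_less \<sigma> y x}) ` X \<union> (\<lambda>x. {y \<in> X. sel_less \<sigma> x y}) ` X))"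

definition separately_continuous_weak_selection :: "'a topology \<Rightarrow> ('a set \<Rightarrow> 'a) \<Rightarrow> bool" where
  "separately_continuous_weak_selection T \<sigma> \<longleftrightarrow>
     weak_selection (topspace T) \<sigma> \<and>
     (\<forall>U. openin (selection_topology (topspace T) \<sigma>) U \<longrightarrow> openin T U)"

definition quasi_king :: "'a set \<Rightarrow> ('a set \<Rightarrow> 'a) \<Rightarrow> 'a \<Rightarrow> bool" where
  "quasi_king X \<sigma> q \<longleftrightarrow> q \<in> X \<and>
     (\<forall>x\<in>X. \<exists>ys. ys \<noteq> [] \<and> set ys \<subseteq> X \<and> successively (sel_le \<sigma>) (x # ys @ [q]))"

definition quasi_king_space :: "'a topology \<Rightarrow> bool" where
  "quasi_king_space T \<longleftrightarrow>
     (\<exists>\<sigma>. separately_continuous_weak_selection T \<sigma>) \<and>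
     (\<forall>\<sigma>. separately_continuous_weak_selection T \<sigma> \<longrightarrow> (\<exists>q. quasi_king (topspace T) \<sigma> q))"

end

theory Submission
  imports Defs
begin

text \<open>Write \<open>x \<le>\<^sup>* y\<close> if some finite chain of \<open>sel_le \<sigma>\<close>-steps leads from \<open>x\<close> to \<open>y\<close>. Although
  \<open>sel_le \<sigma>\<close> itself need not be transitive, \<open>\<le>\<^sup>*\<close> is a total preorder, and a quasi-king is exactly a
  \<open>\<le>\<^sup>*\<close>-greatest point. A point that lies \<open>\<sigma>\<close>-below no other point is already such a
  point, by totality. If there is none, then the open rays \<open>{x. x <\<^sub>\<sigma> y}\<close> cover the space, and
  compactness of the selection topology leaves finitely many rays, with endpoints \<open>y\<^sub>1, \<dots>, y\<^sub>n\<close>.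
  Every point is one step below some \<open>y\<^sub>i\<close>, so a \<open>\<le>\<^sup>*\<close>-greatest one among the \<open>y\<^sub>i\<close>
  (\<open>finite_total_preorder_has_greatest\<close>) is a quasi-king. Thus each single selection with compact
  topology has a quasi-king (\<open>compact_selection_topology_imp_quasi_king\<close>); the hypothesis on
  \<open>T\<close> supplies the compactness for every separately continuous selection.\<close>

lemma finite_total_preorder_has_greatest:
  assumes "finite A" "A \<noteq> {}" "reflp_on A R" "transp R" "totalp_on A R"
  shows "\<exists>q\<in>A. \<forall>x\<in>A. R x q"
  using assms
proof (induction A rule: finite_ne_induct)
  case (singleton a)
  then show ?case by (auto simp: reflp_on_def)
next
  case (insert a A)
  then obtain q where q: "q \<in> A" "\<forall>x\<in>A. R x q"
    by (auto simp: reflp_on_def totalp_on_def)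
  have "R a a" "R a q \<or> R q a"
    using insert.prems insert.hyps q(1) by (auto simp: reflp_on_def totalp_on_def)
  then show ?case
    using q \<open>transp R\<close> by (metis insert_iff transpD)
qed

lemma weak_selection_pair:
  assumes "weak_selection X \<sigma>" "x \<in> X" "y \<in> X"
  shows "\<sigma> {x, y} \<in> {x, y}"
proof -
  have "{x, y} \<in> F2 X"
    using assms(2,3) by (auto simp: F2_def card_insert_if)
  then show ?thesis
    using assms(1) unfolding weak_selection_def by blast
qed

lemma sel_le_total:
  assumes "weak_selection X \<sigma>" "x \<in> X" "y \<in> X"
  shows "sel_le \<sigma> x y \<or> sel_le \<sigma> y x"
  using weak_selection_pair[OF assms] by (auto simp: sel_le_def insert_commute)

lemma topspace_selection_topology: "topspace (selection_topology X \<sigma>) = X"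
  by (auto simp: selection_topology_def)

lemma openin_selection_topology_lower_ray:
  assumes "x \<in> X"
  shows "openin (selection_topology X \<sigma>) {y \<in> X. sel_less \<sigma> y x}"
  unfolding selection_topology_def
  using assms by (intro topology_generated_by_Basis) auto

definition sel_reach :: "'a set \<Rightarrow> ('a set \<Rightarrow> 'a) \<Rightarrow> 'a \<Rightarrow> 'a \<Rightarrow> bool" where
  "sel_reach X \<sigma> = (\<lambda>x y. x \<in> X \<and> y \<in> X \<and> sel_le \<sigma> x y)\<^sup>*\<^sup>*"

lemma sel_reach_step: "x \<in> X \<Longrightarrow> y \<in> X \<Longrightarrow> sel_le \<sigma> x y \<Longrightarrow> sel_reach X \<sigma> x y"
  by (auto simp: sel_reach_def)

lemma transp_sel_reach: "transp (sel_reach X \<sigma>)"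
  unfolding sel_reach_def by (intro transpI) (rule rtranclp_trans)

text \<open>A quasi-king demands a nonempty list of intermediate points. Reflexivity of \<open>sel_le \<sigma>\<close>
  absorbs this: the endpoint \<open>q\<close> itself can serve as an intermediate point.\<close>
lemma sel_reach_imp_chain:
  assumes "weak_selection X \<sigma>" "q \<in> X" "sel_reach X \<sigma> x q"
  shows "\<exists>ys. ys \<noteq> [] \<and> set ys \<subseteq> X \<and> successively (sel_le \<sigma>) (x # ys @ [q])"
  using assms(3) unfolding sel_reach_def
proof (induction rule: converse_rtranclp_induct)
  case base
  have "sel_le \<sigma> q q"
    using sel_le_total[OF assms(1,2,2)] by simp
  then show ?case
    using assms(2) by (intro exI[of _ "[q]"]) simp
next
  case (step x z)
  then obtain ys where "set ys \<subseteq> X" "successively (sel_le \<sigma>) (z # ys @ [q])"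
    by blast
  then show ?case
    using step.hyps by (intro exI[of _ "z # ys"]) simp
qed

lemma quasi_kingI:
  assumes "weak_selection X \<sigma>" "q \<in> X" "\<And>x. x \<in> X \<Longrightarrow> sel_reach X \<sigma> x q"
  shows "quasi_king X \<sigma> q"
  using sel_reach_imp_chain[OF assms(1,2)] assms(2,3) by (simp add: quasi_king_def)

theorem compact_selection_topology_imp_quasi_king:
  assumes sel: "weak_selection X \<sigma>" and "X \<noteq> {}"
    and compact: "compact_space (selection_topology X \<sigma>)"
  shows "\<exists>q. quasi_king X \<sigma> q"
proof (cases "\<exists>q\<in>X. \<forall>y\<in>X. \<not> sel_less \<sigma> q y")
  case True
  then obtain q where q: "q \<in> X" "\<And>y. y \<in> X \<Longrightarrow> \<not> sel_less \<sigma> q y"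
    by blast
  have "sel_le \<sigma> x q" if "x \<in> X" for x
    using sel_le_total[OF sel that q(1)] q(2)[OF that] by (auto simp: sel_less_def)
  then show ?thesis
    using quasi_kingI[OF sel q(1)] sel_reach_step[OF _ q(1)] by blast
next
  case False
  define ray where "ray y = {x \<in> X. sel_less \<sigma> x y}" for y
  have "X \<subseteq> \<Union> (ray ` X)"
    using False by (auto simp: ray_def)
  moreover have "\<forall>U\<in>ray ` X. openin (selection_topology X \<sigma>) U"
    unfolding ray_def by (auto intro: openin_selection_topology_lower_ray)
  ultimately obtain F where "finite F" "F \<subseteq> ray ` X" "X \<subseteq> \<Union> F"
    using compact unfolding compact_space_alt topspace_selection_topology by meson
  then obtain Y where Y: "finite Y" "Y \<subseteq> X" "X \<subseteq> \<Union> (ray ` Y)"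
    by (metis finite_subset_image)
  then have "Y \<noteq> {}"
    using \<open>X \<noteq> {}\<close> by auto
  moreover have "reflp_on Y (sel_reach X \<sigma>)"
    by (simp add: reflp_on_def sel_reach_def)
  moreover have "totalp_on Y (sel_reach X \<sigma>)"
    using sel_le_total[OF sel] sel_reach_step Y(2) by (metis subsetD totalp_onI)
  ultimately obtain q where q: "q \<in> Y" "\<forall>y\<in>Y. sel_reach X \<sigma> y q"
    using finite_total_preorder_has_greatest[OF Y(1)] transp_sel_reach by metis
  have "sel_reach X \<sigma> x q" if "x \<in> X" for x
  proof -
    obtain y where y: "y \<in> Y" "sel_le \<sigma> x y"
      using Y(3) \<open>x \<in> X\<close> by (auto simp: ray_def sel_less_def)
    then have "sel_reach X \<sigma> x y"
      using \<open>x \<in> X\<close> Y(2) by (auto intro: sel_reach_step)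
    then show ?thesis
      using q(2) y(1) transp_sel_reach by (metis transpD)
  qed
  then show ?thesis
    using quasi_kingI[OF sel] q(1) Y(2) by blast
qed

theorem corollary3p5:
  fixes T :: "'a topology"
  assumes "Hausdorff_space T"
    and "topspace T \<noteq> {}"
    and "\<exists>\<sigma>. separately_continuous_weak_selection T \<sigma>"
    and "\<And>\<sigma>. separately_continuous_weak_selection T \<sigma>
           \<Longrightarrow> compact_space (selection_topology (topspace T) \<sigma>)"
  shows "quasi_king_space T"
  unfolding quasi_king_space_def
proof (intro conjI allI impI)
  show "\<exists>\<sigma>. separately_continuous_weak_selection T \<sigma>"
    by (fact assms(3))
next
  fix \<sigma>
  assume \<sigma>: "separately_continuous_weak_selection T \<sigma>"
  then have "weak_selection (topspace T) \<sigma>"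
    by (simp add: separately_continuous_weak_selection_def)
  then show "\<exists>q. quasi_king (topspace T) \<sigma> q"
    using assms(2) assms(4)[OF \<sigma>] by (rule compact_selection_topology_imp_quasi_king)
qed

end
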